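(* Let $\mathbb{K}$ be a field of characteristic zero and $S=\bigoplus_{n\ge 1}S_n$ a graded associative $\mathbb{K}$-algebra. Then $(\mathcal{J}^g(S),\circ)$ is a group if and only if $S[S,S]=0$.
   Context: Algebras are not assumed commutative. $[x,y]:=xy-yx$, and $S[S,S]=0$ means $x(yz-zy)=0$ for all $x,y,z\in S$. $\hat S=\prod_{n\ge 1}S_n$ is the completion of $S$ with respect to the grading. $\mathcal{J}^g(S):=1+\hat S$, where $1$ is a formal unit element; its elements are written $\sum_{n\ge 0}\alpha_n$ with $\alpha_0=1$ and $\alpha_n\in S_n$ for $n\ge 1$. The product $\circ$ is $$\Big(\sum_{m\ge 0}\alpha_m\Big)\circ\Big(\sum_{n\ge 0}\beta_n\Big):=\sum_{m\ge 0}\alpha_m\Big(\sum_{n\ge 0}\beta_n\Big)^{m+1},$$ where the right-hand side is computed in the associative unital algebra obtained by adjoining $1$ to $\hat S$. *)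

theory Defs
  imports
    "HOL-Algebra.Group"
    "HOL-Computational_Algebra.Formal_Power_Series"
    "HOL-Library.Groups_Big_Fun"
begin

text \<open>
  The algebra is a whole type of class \<open>ring\<close> (associative, no unit, not necessarily commutative)
  with scalar multiplication \<open>scale\<close>. The grading is written with indices in \<open>nat\<close>; the component
  of degree 0 is the zero space, so that \<open>S = (\<Oplus>n\<ge>1. G n)\<close>.
\<close>

locale graded_algebra = vector_space scale
  for scale :: "'k::field \<Rightarrow> 'a::ring \<Rightarrow> 'a" +
  fixes G :: "nat \<Rightarrow> 'a set"
  assumes scale_mult_left: "scale c x * y = scale c (x * y)"
    and scale_mult_right: "x * scale c y = scale c (x * y)"
    and subspace_component: "subspace (G n)"
    and component_0: "G 0 = {0}"
    and component_mult: "x \<in> G m \<Longrightarrow> y \<in> G n \<Longrightarrow> x * y \<in> G (m + n)"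
    and direct_sum: "\<exists>!c. (\<forall>n. c n \<in> G n) \<and> finite {n. c n \<noteq> 0} \<and> x = Sum_any c"

text \<open>
  An element of \<open>\<Prod>n\<ge>1. G n\<close> is stored as the formal power series whose \<open>n\<close>-th coefficient is its
  component of degree \<open>n\<close>; the Cauchy product of series is then the product of the completion.
\<close>

definition completion :: "(nat \<Rightarrow> 'a::zero set) \<Rightarrow> 'a fps set" where
  "completion G = {f. \<forall>n. fps_nth f n \<in> G n}"

definition fps_scale :: "('k \<Rightarrow> 'a \<Rightarrow> 'a) \<Rightarrow> 'k \<Rightarrow> 'a fps \<Rightarrow> 'a fps" where
  "fps_scale scale c f = Abs_fps (\<lambda>n. scale c (fps_nth f n))"

text \<open>
  The completion with a unit adjoined; the pair \<open>(c, f)\<close> stands for \<open>c \<cdot> 1 + f\<close>.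
\<close>

definition unitization ::
    "('k::field \<Rightarrow> 'a::ring \<Rightarrow> 'a) \<Rightarrow> (nat \<Rightarrow> 'a set) \<Rightarrow> ('k \<times> 'a fps) monoid" where
  "unitization scale G =
    \<lparr>carrier = UNIV \<times> completion G,
     monoid.mult = (\<lambda>(c, f) (d, g). (c * d, fps_scale scale c g + fps_scale scale d f + f * g)),
     one = (1, 0)\<rparr>"

text \<open>The homogeneous component of degree \<open>m\<close>; the scalars have degree 0.\<close>

definition hom_component :: "nat \<Rightarrow> 'k \<times> 'a fps \<Rightarrow> 'k::zero \<times> 'a::zero fps" where
  "hom_component m \<alpha> =
    (if m = 0 then (fst \<alpha>, 0)
     else (0, Abs_fps (\<lambda>n. if n = m then fps_nth (snd \<alpha>) m else 0)))"

text \<open>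
  Infinite sums are taken degree by degree. \<open>Sum_any\<close> is the sum over the indices with nonzero
  summand, and is 0 if there are infinitely many of these; the lemmas at the end exclude this case
  for the families summed here.
\<close>

definition gradedwise_sum ::
    "(nat \<Rightarrow> 'k \<times> 'a fps) \<Rightarrow> 'k::comm_monoid_add \<times> 'a::comm_monoid_add fps" where
  "gradedwise_sum t =
    (Sum_any (\<lambda>m. fst (t m)), Abs_fps (\<lambda>n. Sum_any (\<lambda>m. fps_nth (snd (t m)) n)))"

definition Jg_summand ::
    "('k::field \<Rightarrow> 'a::ring \<Rightarrow> 'a) \<Rightarrow> (nat \<Rightarrow> 'a set) \<Rightarrow>
      'k \<times> 'a fps \<Rightarrow> 'k \<times> 'a fps \<Rightarrow> nat \<Rightarrow> 'k \<times> 'a fps" where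
  "Jg_summand scale G \<alpha> \<beta> m =
    hom_component m \<alpha> \<otimes>\<^bsub>unitization scale G\<^esub> (\<beta> [^]\<^bsub>unitization scale G\<^esub> (m + 1))"

definition Jg ::
    "('k::field \<Rightarrow> 'a::ring \<Rightarrow> 'a) \<Rightarrow> (nat \<Rightarrow> 'a set) \<Rightarrow> ('k \<times> 'a fps) monoid" where
  "Jg scale G =
    \<lparr>carrier = {1} \<times> completion G,
     monoid.mult = (\<lambda>\<alpha> \<beta>. gradedwise_sum (Jg_summand scale G \<alpha> \<beta>)),
     one = (1, 0)\<rparr>"

context graded_algebra
begin

lemma fst_Jg_summand_eq_0: "m > 0 \<Longrightarrow> fst (Jg_summand scale G \<alpha> \<beta> m) = 0"
  by (simp add: Jg_summand_def unitization_def hom_component_def case_prod_unfold)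

lemma nth_Jg_summand_eq_0: "n < m \<Longrightarrow> fps_nth (snd (Jg_summand scale G \<alpha> \<beta> m)) n = 0"
  by (auto simp: Jg_summand_def unitization_def hom_component_def fps_scale_def case_prod_unfold
      fps_mult_nth intro!: sum.neutral)

lemma finite_support_Jg_summand:
  "finite {m. fst (Jg_summand scale G \<alpha> \<beta> m) \<noteq> 0}"
  "finite {m. fps_nth (snd (Jg_summand scale G \<alpha> \<beta> m)) n \<noteq> 0}"
proof -
  have "{m. fst (Jg_summand scale G \<alpha> \<beta> m) \<noteq> 0} \<subseteq> {0}"
    using fst_Jg_summand_eq_0[of _ \<alpha> \<beta>] by (intro subsetI) (metis (mono_tags, lifting) gr0I mem_Collect_eq singletonI)
  then show "finite {m. fst (Jg_summand scale G \<alpha> \<beta> m) \<noteq> 0}"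
    by (rule finite_subset) simp
  have "{m. fps_nth (snd (Jg_summand scale G \<alpha> \<beta> m)) n \<noteq> 0} \<subseteq> {..n}"
    using nth_Jg_summand_eq_0[of n _ \<alpha> \<beta>] by (intro subsetI) (metis (mono_tags, lifting) atMost_iff mem_Collect_eq not_less)
  then show "finite {m. fps_nth (snd (Jg_summand scale G \<alpha> \<beta> m)) n \<noteq> 0}"
    by (rule finite_subset) simp
qed

end

end

theory Submission
  imports Defs
begin

unbundle fps_syntax

text \<open>
  The product of \<open>J(S)\<close> is a composition of power series. Let \<open>U\<close> be \<open>S\<close> with a unit
  adjoined, and attach to \<open>\<alpha> = \<Sum> \<alpha>\<^sub>n\<close> the series \<open>F\<^sub>\<alpha> = \<Sum> \<alpha>\<^sub>n X\<^bsup>n+1\<^esup>\<close> over \<open>U\<close>, with the variable \<open>X\<close> central.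
  Then \<open>F\<^bsub>\<alpha>\<circ>\<beta>\<^esub>\<close> is \<open>F\<^sub>\<alpha> oo F\<^sub>\<beta>\<close>, where substitution keeps the coefficients of the outer series on the left
  (\<open>tangent_series_Jg_product\<close>). The question is thus when series of the form \<open>X + \<dots>\<close>, whose higher
  coefficients lie in \<open>S\<close>, compose associatively. The neutral element is \<open>X\<close>, and left inverses
  always exist, because the component of \<open>\<alpha> \<circ> \<beta>\<close> of degree \<open>n\<close> is \<open>\<alpha>\<^sub>n\<close> plus terms in
  \<open>\<beta>\<close> and in the \<open>\<alpha>\<^sub>m\<close> with \<open>m < n\<close> (\<open>Jg_left_inverse\<close>).

  Both bracketings of \<open>F oo G oo H\<close> expand as sums over \<open>i\<close>: one has the summands
  \<open>F\<^sub>i (G\<^sup>i oo H)\<close>, the other \<open>F\<^sub>i (G oo H)\<^sup>i\<close>. They agree for \<open>i \<le> 1\<close>. For \<open>i \<ge> 2\<close> the coefficient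
  \<open>F\<^sub>i\<close> lies in \<open>S\<close>; if \<open>S[S,S] = 0\<close>, then \<open>F\<^sub>i\<close> annihilates all commutators of \<open>U\<close> from the left, and to
  the right of such an element substitution of \<open>H\<close> is multiplicative, as it is over a commutative ring
  (\<open>fps_compose_assoc_annihilator\<close>).

  Conversely, let \<open>a\<close>, \<open>b\<close>, \<open>c\<close> be homogeneous of degrees \<open>m\<close>, \<open>n\<close>, \<open>p\<close>, and compare the bracketings for
  \<open>F = X + a X\<^bsup>m+1\<^esup>\<close>, \<open>G = X + b X\<^bsup>n+1\<^esup>\<close>, \<open>H = X + c X\<^bsup>p+1\<^esup>\<close>. The difference is
  \<open>a ((G oo H)\<^bsup>m+1\<^esup> - G\<^bsup>m+1\<^esup> oo H)\<close>, whose lowest coefficient is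
  \<open>(m+1 choose 2) a [c,b]\<close> (\<open>leading_power_compose_defect\<close>). In characteristic zero associativity
  therefore forces \<open>a [c,b] = 0\<close>, and this identity extends to all of \<open>S\<close> by additivity.
\<close>

section \<open>Power series composition over a noncommutative ring\<close>

lemma fps_compose_const_mult_left:
  "(fps_const c * f) oo g = fps_const (c :: 'r::semiring_1) * (f oo g)"
  by (simp add: fps_eq_iff fps_compose_nth sum_distrib_left mult.assoc)

lemma fps_X_compose:
  "g $ 0 = 0 \<Longrightarrow> fps_X oo g = (g :: 'r::semiring_1 fps)"
  by (simp add: fps_eq_iff fps_compose_nth mult_delta_left not_le)

lemma fps_power_nth_eq_0:
  "(g :: 'r::semiring_1 fps) $ 0 = 0 \<Longrightarrow> n < k \<Longrightarrow> (g ^ k) $ n = 0"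
proof (induction k arbitrary: n)
  case (Suc k)
  have "g $ i * (g ^ k) $ (n - i) = 0" if "i \<le> n" for i
    by (cases "i = 0") (use that Suc.prems Suc.IH[of "n - i"] in auto)
  then show ?case
    by (simp add: fps_mult_nth)
qed simp

lemma fps_compose_nth_superset:
  assumes "(g :: 'r::semiring_1 fps) $ 0 = 0" "n \<le> N"
  shows "(f oo g) $ n = (\<Sum>i\<le>N. f $ i * (g ^ i) $ n)"
  unfolding fps_compose_nth using assms
  by (intro sum.mono_neutral_left) (auto simp: fps_power_nth_eq_0)

text \<open>
  Substitution is not multiplicative over a noncommutative ring, since the coefficients of the right
  factor would have to pass the powers of \<open>h\<close>. A power of \<open>X\<close> has central coefficients, so no such
  exchange occurs.
\<close>

lemma fps_compose_mult_X_power: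
  assumes "(h :: 'r::semiring_1 fps) $ 0 = 0"
  shows "(p * fps_X ^ k) oo h = (p oo h) * h ^ k"
proof (rule fps_ext)
  fix n
  have "((p * fps_X ^ k) oo h) $ n = (\<Sum>i\<le>n + k. (p * fps_X ^ k) $ i * (h ^ i) $ n)"
    using assms by (rule fps_compose_nth_superset) simp
  also have "\<dots> = (\<Sum>i\<in>{k..n + k}. p $ (i - k) * (h ^ i) $ n)"
    by (rule sum.mono_neutral_cong_right) (auto simp: fps_X_power_mult_right_nth)
  also have "\<dots> = (\<Sum>i\<le>n. p $ i * (h ^ (i + k)) $ n)"
    by (rule sum.reindex_bij_witness[of _ "\<lambda>i. i + k" "\<lambda>i. i - k"]) auto
  also have "\<dots> = (\<Sum>i\<le>n. \<Sum>j=0..n. p $ i * ((h ^ i) $ j * (h ^ k) $ (n - j)))"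
    by (simp add: power_add fps_mult_nth sum_distrib_left)
  also have "\<dots> = (\<Sum>j=0..n. (\<Sum>i\<le>n. p $ i * (h ^ i) $ j) * (h ^ k) $ (n - j))"
    by (subst sum.swap) (simp add: sum_distrib_right mult.assoc)
  also have "\<dots> = ((p oo h) * h ^ k) $ n"
    using assms by (simp add: fps_mult_nth fps_compose_nth_superset[of h _ n])
  finally show "((p * fps_X ^ k) oo h) $ n = ((p oo h) * h ^ k) $ n" .
qed

definition annihilates_commutators :: "'r::ring_1 \<Rightarrow> bool" where
  "annihilates_commutators c \<longleftrightarrow> (\<forall>u v. c * (u * v) = c * (v * u))"

text \<open>
  The elements annihilating all commutators form a right ideal, because
  \<open>c w u v\<close> equals \<open>c v w u\<close>, moving \<open>v\<close> across the product \<open>w u\<close>, and then \<open>c w v u\<close>.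
\<close>

lemma annihilates_commutators_mult:
  assumes "annihilates_commutators c"
  shows "annihilates_commutators (c * w)"
  using assms unfolding annihilates_commutators_def by (metis mult.assoc)

text \<open>
  To the right of \<open>c\<close>, all factors commute, so the coefficients of \<open>q\<close> may be moved past the powers of
  \<open>h\<close> as over a commutative ring. Writing \<open>q = u + r X\<close> turns this into an induction: the constant \<open>u\<close>
  needs one exchange, and the factor \<open>X\<close> becomes a right factor \<open>h\<close>, which has no constant term and so
  reduces the claim for \<open>r\<close> to coefficients of smaller index.
\<close>

lemma fps_compose_mult_annihilator:
  assumes h0: "h $ 0 = 0" and c: "annihilates_commutators c"
  shows "fps_const c * ((p * q) oo h) = fps_const c * ((p oo h) * (q oo h))"
proof (rule fps_ext)
  fix n
  show "(fps_const c * ((p * q) oo h)) $ n = (fps_const c * ((p oo h) * (q oo h))) $ n"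
  proof (induction n arbitrary: q rule: less_induct)
    case (less n)
    define r where "r = fps_shift 1 q"
    have q: "q = fps_const (q $ 0) + r * fps_X"
      unfolding r_def by (rule fps_ext) auto
    have const: "fps_const c * ((p * fps_const u) oo h) = fps_const c * ((p oo h) * fps_const u)" for u
    proof (rule fps_ext)
      fix k
      have "c * (p $ i * u * (h ^ i) $ k) = c * (p $ i * (h ^ i) $ k * u)" for i
        using annihilates_commutators_mult[OF c, of "p $ i"]
        by (simp add: annihilates_commutators_def mult.assoc)
      then show "(fps_const c * ((p * fps_const u) oo h)) $ k =
          (fps_const c * ((p oo h) * fps_const u)) $ k"
        by (simp add: fps_compose_nth sum_distrib_left sum_distrib_right)
    qed
    have X: "(f * fps_X) oo h = (f oo h) * h" for f
      using fps_compose_mult_X_power[OF h0, of f 1] by simp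
    have qh: "q oo h = fps_const (q $ 0) + (r oo h) * h"
      by (subst q) (simp add: fps_compose_add_distrib X fps_eq_iff fps_compose_nth mult_delta_left)
    have pqh: "(p * q) oo h = ((p * fps_const (q $ 0)) oo h) + ((p * r) oo h) * h"
      by (subst q) (simp add: distrib_left fps_compose_add_distrib X flip: mult.assoc)
    have "(fps_const c * ((p * r) oo h) * h) $ n = (fps_const c * ((p oo h) * (r oo h)) * h) $ n"
      unfolding fps_mult_nth[of _ h]
    proof (rule sum.cong[OF refl])
      fix i assume i: "i \<in> {0..n}"
      show "(fps_const c * ((p * r) oo h)) $ i * h $ (n - i) =
            (fps_const c * ((p oo h) * (r oo h))) $ i * h $ (n - i)"
      proof (cases "i = n")
        case True
        then show ?thesis using h0 by simp
      next
        case False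
        then show ?thesis using less[of i r] i by simp
      qed
    qed
    then show ?case
      unfolding pqh qh distrib_left fps_add_nth by (simp only: mult.assoc const)
  qed
qed

lemma fps_compose_power_annihilator:
  assumes "h $ 0 = 0" "annihilates_commutators c"
  shows "fps_const c * (g ^ k oo h) = fps_const c * (g oo h) ^ k"
proof (induction k)
  case (Suc k)
  have "fps_const c * (g ^ Suc k oo h) = fps_const c * ((g ^ k oo h) * (g oo h))"
    using fps_compose_mult_annihilator[OF assms] by (simp only: power_Suc2)
  also have "\<dots> = (fps_const c * (g oo h) ^ k) * (g oo h)"
    by (simp only: mult.assoc[symmetric] Suc)
  finally show ?case by (simp only: power_Suc2 mult.assoc)
qed simp

text \<open>
  The sum for \<open>(f oo g) oo h\<close> can be regrouped by the coefficients of \<open>f\<close>, since these always stand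
  leftmost. Comparing with the definition of \<open>f oo (g oo h)\<close>, associativity fails only as far as
  \<open>g ^ i oo h\<close> differs from \<open>(g oo h) ^ i\<close>.
\<close>

lemma fps_compose_compose_nth:
  assumes "(g :: 'r::semiring_1 fps) $ 0 = 0" "h $ 0 = 0"
  shows "((f oo g) oo h) $ n = (\<Sum>i\<le>n. f $ i * (g ^ i oo h) $ n)"
proof -
  have "((f oo g) oo h) $ n = (\<Sum>j\<le>n. \<Sum>i\<le>n. f $ i * ((g ^ i) $ j * (h ^ j) $ n))"
    using assms by (simp add: fps_compose_nth_superset[of _ _ n] sum_distrib_right mult.assoc)
  also have "\<dots> = (\<Sum>i\<le>n. f $ i * (g ^ i oo h) $ n)"
    using assms by (subst sum.swap) (simp add: fps_compose_nth_superset[of _ _ n] sum_distrib_left)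
  finally show ?thesis .
qed

text \<open>
  The first two coefficients of \<open>f\<close> are unrestricted: \<open>g ^ i oo h\<close> is \<open>(g oo h) ^ i\<close> for
  \<open>i = 0\<close> and \<open>i = 1\<close> anyway. This matters because the linear coefficient in the application is \<open>1\<close>,
  which annihilates commutators only in a commutative ring.
\<close>

lemma fps_compose_assoc_annihilator:
  assumes g0: "g $ 0 = 0" and h0: "h $ 0 = 0"
    and f: "\<And>i. i \<ge> 2 \<Longrightarrow> annihilates_commutators (f $ i)"
  shows "(f oo g) oo h = f oo (g oo h)"
proof (rule fps_ext)
  fix n
  have "f $ i * (g ^ i oo h) $ n = f $ i * ((g oo h) ^ i) $ n" for i
  proof -
    consider "i = 0" | "i = 1" | "i \<ge> 2" by linarith
    then show ?thesis
    proof cases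
      case 3
      from fps_compose_power_annihilator[OF h0 f[OF this]] show ?thesis
        by (metis fps_mult_left_const_nth)
    qed auto
  qed
  then show "((f oo g) oo h) $ n = (f oo (g oo h)) $ n"
    using g0 by (simp only: fps_compose_compose_nth[OF g0 h0] fps_compose_nth[of f "g oo h"] atMost_atLeast0)
qed

section \<open>The obstruction to associativity\<close>

text \<open>
  The coefficient \<open>d\<close> may vanish, so \<open>r\<close> is a lower bound for the order of \<open>f\<close> rather than the order.
  Leading terms can then be added and multiplied without case distinctions.
\<close>

definition leading :: "nat \<Rightarrow> 'r::zero \<Rightarrow> 'r fps \<Rightarrow> bool" where
  "leading r d f \<longleftrightarrow> (\<forall>j<r. f $ j = 0) \<and> f $ r = d"

lemma leading_add: "leading r d f \<Longrightarrow> leading r e g \<Longrightarrow> leading r (d + e) (f + g)"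
  for d :: "'r::ring_1"
  by (simp add: leading_def)

lemma leading_mult:
  fixes d :: "'r::ring_1"
  assumes "leading r d f" "leading s e g"
  shows "leading (r + s) (d * e) (f * g)"
proof -
  have z: "f $ i * g $ (j - i) = 0" if "j \<le> r + s" "i \<noteq> r \<or> j \<noteq> r + s" "i \<le> j" for i j
  proof -
    have "i < r \<or> j - i < s" using that by linarith
    then show ?thesis using assms by (auto simp: leading_def)
  qed
  have "(f * g) $ (r + s) = (\<Sum>i\<in>{r}. f $ i * g $ (r + s - i))"
    unfolding fps_mult_nth by (rule sum.mono_neutral_right) (auto intro: z)
  moreover have "(f * g) $ j = 0" if "j < r + s" for j
    unfolding fps_mult_nth using that by (intro sum.neutral ballI z) auto
  ultimately show ?thesis
    using assms by (simp add: leading_def)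
qed

lemma leading_power:
  fixes f :: "'r::ring_1 fps"
  assumes "leading 1 1 f"
  shows "leading k 1 (f ^ k)"
proof (induction k)
  case 0
  then show ?case by (simp add: leading_def)
next
  case (Suc k)
  then show ?case using leading_mult[OF assms Suc] by simp
qed

lemma leading_compose:
  fixes f :: "'r::ring_1 fps"
  assumes "leading 1 1 g" "leading r d f"
  shows "leading r d (f oo g)"
proof -
  have "f $ i * (g ^ i) $ j = 0" if "j \<le> r" "i \<noteq> r \<or> j \<noteq> r" for i j
  proof -
    have "i < r \<or> j < i" using that by linarith
    then show ?thesis using assms leading_power[OF assms(1), of i] by (auto simp: leading_def)
  qed
  note z = this
  have "(f oo g) $ r = (\<Sum>i\<in>{r}. f $ i * (g ^ i) $ r)"
    unfolding fps_compose_nth by (rule sum.mono_neutral_right) (auto intro: z)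
  moreover have "(f oo g) $ j = 0" if "j < r" for j
    unfolding fps_compose_nth using that by (intro sum.neutral ballI z) auto
  ultimately show ?thesis
    using assms leading_power[OF assms(1), of r] by (simp add: leading_def)
qed

definition perturbed_X :: "'r::ring_1 \<Rightarrow> nat \<Rightarrow> 'r fps" where
  "perturbed_X b n = fps_X + fps_const b * fps_X ^ (n + 1)"

lemma leading_perturbed_X: "n > 0 \<Longrightarrow> leading 1 1 (perturbed_X b n)"
  by (auto simp: leading_def perturbed_X_def simp flip: power_Suc)

lemma perturbed_X_compose:
  assumes "(g :: 'r::ring_1 fps) $ 0 = 0"
  shows "perturbed_X b n oo g = g + fps_const b * g ^ (n + 1)"
  using fps_compose_mult_X_power[OF assms, of 1 "n + 1"] assms
  by (simp add: perturbed_X_def fps_compose_add_distrib fps_X_compose fps_compose_const_mult_left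
      del: power_Suc)

text \<open>
  Modulo higher order \<open>h ^ k\<close> is \<open>X ^ k + k c X ^ (k + p)\<close>; the first term is central, and the second
  contributes \<open>k [c,b]\<close>. The induction is the Leibniz rule for the commutator with \<open>b\<close>.
\<close>

lemma leading_power_commutator:
  fixes b c :: "'r::ring_1"
  assumes p: "p > 0"
  defines "h \<equiv> perturbed_X c p"
  shows "leading (k + p) (of_nat k * (c * b - b * c)) (h ^ k * fps_const b - fps_const b * h ^ k)"
proof (induction k)
  case 0
  then show ?case by (simp add: leading_def)
next
  case (Suc k)
  have h: "leading 1 1 h" using p by (simp only: h_def leading_perturbed_X)
  have "fps_const b * fps_X = fps_X * fps_const b"
    by (simp add: fps_mult_fps_X_commute)
  then have "h * fps_const b - fps_const b * h
      = fps_const (c * b - b * c) * fps_X ^ (p + 1)"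
    unfolding h_def perturbed_X_def fps_eq_iff
    by (auto simp: fps_X_power_mult_right_nth algebra_simps simp del: power_Suc)
  then have "leading (p + 1) (c * b - b * c) (h * fps_const b - fps_const b * h)"
    by (simp add: leading_def del: power_Suc)
  from leading_mult[OF leading_power[OF h, of k] this]
  have "leading (Suc k + p) (c * b - b * c) (h ^ k * (h * fps_const b - fps_const b * h))"
    by (simp add: add_ac)
  moreover have "leading (Suc k + p) (of_nat k * (c * b - b * c))
      ((h ^ k * fps_const b - fps_const b * h ^ k) * h)"
    using leading_mult[OF Suc h] by (simp add: add_ac)
  ultimately have "leading (Suc k + p) ((c * b - b * c) + of_nat k * (c * b - b * c))
      (h ^ k * (h * fps_const b - fps_const b * h) + (h ^ k * fps_const b - fps_const b * h ^ k) * h)"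
    by (rule leading_add)
  moreover have "h ^ k * (h * fps_const b - fps_const b * h) + (h ^ k * fps_const b - fps_const b * h ^ k) * h
      = h ^ Suc k * fps_const b - fps_const b * h ^ Suc k"
    by (simp only: power_Suc2) (simp add: algebra_simps)
  ultimately show ?case
    by (simp only: of_nat_Suc distrib_right mult_1_left)
qed

text \<open>
  Passing from \<open>k\<close> to \<open>k + 1\<close> multiplies the defect by \<open>g oo h\<close>, which keeps its leading coefficient,
  and adds the error made by moving \<open>b\<close> from the left of \<open>h ^ i\<close> to its right, for each term
  \<open>X ^ i\<close> of \<open>g ^ k\<close>. Only \<open>i = k\<close> reaches the lowest degree, and there the error is \<open>k [c,b]\<close>. Hence the
  leading coefficient is \<open>0 + 1 + \<dots> + (k - 1)\<close> times \<open>[c,b]\<close>.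
\<close>

lemma leading_power_compose_defect:
  fixes b c :: "'r::ring_1"
  assumes n: "n > 0" and p: "p > 0"
  defines "g \<equiv> perturbed_X b n" and "h \<equiv> perturbed_X c p"
  shows "leading (k + n + p) (of_nat (k choose 2) * (c * b - b * c)) ((g oo h) ^ k - (g ^ k oo h))"
proof (induction k)
  case 0
  then show ?case by (simp add: leading_def numeral_2_eq_2)
next
  case (Suc k)
  have g: "leading 1 1 g" and h: "leading 1 1 h"
    using n p by (simp_all only: g_def h_def leading_perturbed_X)
  have h0: "h $ 0 = 0"
    using h by (simp add: leading_def)
  have gh: "g oo h = h + fps_const b * h ^ (n + 1)"
    unfolding g_def by (rule perturbed_X_compose[OF h0])
  (* C collects the errors of moving b across the powers of h. *)
  define C where "C = (g ^ k oo h) * fps_const b - ((g ^ k * fps_const b) oo h)"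
  have "(g ^ k * g) oo h = (g ^ k oo h) * h + ((g ^ k * fps_const b) oo h) * h ^ (n + 1)"
    using fps_compose_mult_X_power[OF h0, of "g ^ k * fps_const b" "n + 1"]
      fps_compose_mult_X_power[OF h0, of "g ^ k" 1]
    by (subst (2) g_def)
      (simp add: perturbed_X_def distrib_left fps_compose_add_distrib mult.assoc del: power_Suc)
  then have split: "(g oo h) ^ Suc k - (g ^ Suc k oo h)
      = ((g oo h) ^ k - (g ^ k oo h)) * (g oo h) + C * h ^ (n + 1)"
    unfolding power_Suc2 C_def by (simp add: gh algebra_simps del: power_Suc)
  have C_nth: "C $ j = (\<Sum>i\<le>j. (g ^ k) $ i * (h ^ i * fps_const b - fps_const b * h ^ i) $ j)" for j
    using h0 by (simp add: C_def fps_compose_nth_superset[of h _ j] sum_distrib_right mult.assoc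
        right_diff_distrib sum_subtractf)
  have z: "(g ^ k) $ i * (h ^ i * fps_const b - fps_const b * h ^ i) $ j = 0"
    if "j \<le> k + p" "i \<noteq> k \<or> j \<noteq> k + p" for i j
  proof -
    have "i < k \<or> j < i + p" using that by linarith
    then show ?thesis
      using leading_power[OF g, of k] leading_power_commutator[OF p, of i c b]
      unfolding leading_def h_def by auto
  qed
  have "C $ (k + p) = (\<Sum>i\<in>{k}. (g ^ k) $ i * (h ^ i * fps_const b - fps_const b * h ^ i) $ (k + p))"
    unfolding C_nth
  proof (rule sum.mono_neutral_right)
    show "\<forall>i\<in>{..k + p} - {k}. (g ^ k) $ i * (h ^ i * fps_const b - fps_const b * h ^ i) $ (k + p) = 0"
      by (intro ballI z) auto
  qed auto
  moreover have "C $ j = 0" if "j < k + p" for j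
    unfolding C_nth using that by (intro sum.neutral ballI z) auto
  ultimately have "leading (k + p) (of_nat k * (c * b - b * c)) C"
    using leading_power[OF g, of k] leading_power_commutator[OF p, of k c b]
    by (simp add: leading_def h_def)
  from leading_mult[OF this leading_power[OF h, of "n + 1"]]
  have "leading (Suc k + n + p) (of_nat k * (c * b - b * c)) (C * h ^ (n + 1))"
    by (simp add: add_ac)
  moreover have "leading (Suc k + n + p) (of_nat (k choose 2) * (c * b - b * c))
      (((g oo h) ^ k - (g ^ k oo h)) * (g oo h))"
    using leading_mult[OF Suc leading_compose[OF h g]] by (simp add: add_ac)
  ultimately have "leading (Suc k + n + p)
      (of_nat (k choose 2) * (c * b - b * c) + of_nat k * (c * b - b * c)) ((g oo h) ^ Suc k - (g ^ Suc k oo h))"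
    unfolding split by (rule leading_add[rotated])
  moreover have "of_nat (Suc k choose 2) = (of_nat (k choose 2) + of_nat k :: 'r)"
    by (simp add: numeral_2_eq_2)
  ultimately show ?case
    by (simp add: algebra_simps)
qed

lemma commutator_eq_0_if_compose_assoc:
  fixes a b c :: "'r::ring_1" and m n p :: nat
  assumes n: "n > 0" and p: "p > 0"
  defines "f \<equiv> perturbed_X a m" and "g \<equiv> perturbed_X b n" and "h \<equiv> perturbed_X c p"
  assumes assoc: "(f oo g) oo h = f oo (g oo h)"
  shows "a * (of_nat (Suc m choose 2) * (c * b - b * c)) = 0"
proof -
  have g: "leading 1 1 g" and h: "leading 1 1 h"
    using n p by (simp_all only: g_def h_def leading_perturbed_X)
  have "leading 1 1 (g oo h)"
    using h g by (rule leading_compose)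
  then have *: "g $ 0 = 0" "(g oo h) $ 0 = 0"
    using g by (simp_all add: leading_def)
  have "(g oo h) + fps_const a * (g ^ Suc m oo h) = (g oo h) + fps_const a * (g oo h) ^ Suc m"
    using assoc *
    by (simp add: f_def perturbed_X_compose fps_compose_add_distrib fps_compose_const_mult_left
        del: power_Suc)
  then have "fps_const a * ((g oo h) ^ Suc m - (g ^ Suc m oo h)) = 0"
    by (simp add: right_diff_distrib del: power_Suc)
  then have "a * ((g oo h) ^ Suc m - (g ^ Suc m oo h)) $ (Suc m + n + p) = 0"
    by (metis fps_mult_left_const_nth fps_zero_nth)
  then show ?thesis
    using leading_power_compose_defect[OF n p, of "Suc m" c b]
    by (simp add: leading_def g_def h_def del: power_Suc)
qed

unbundle fps_syntax
section \<open>The Dorroh extension\<close>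

text \<open>
  The multiple \<open>n x\<close>. Without a unit in the ring it cannot be written as a product with the image of \<open>n\<close>.
\<close>

definition int_scale :: "int \<Rightarrow> 'a::ring \<Rightarrow> 'a" where
  "int_scale n x = (\<Sum>i<nat n. x) - (\<Sum>i<nat (- n). x)"

lemma int_scale_0 [simp]: "int_scale 0 x = 0"
  by (simp add: int_scale_def)

lemma int_scale_Suc: "int_scale (n + 1) x = int_scale n x + x"
proof (cases "n \<ge> 0")
  case True
  then have "nat (n + 1) = Suc (nat n)" by simp
  then show ?thesis using True by (simp add: int_scale_def)
next
  case False
  then have "nat (- n) = Suc (nat (- (n + 1)))" by simp
  then show ?thesis using False by (simp add: int_scale_def)
qed

lemma int_scale_pred: "int_scale (n - 1) x = int_scale n x - x"
  using int_scale_Suc[of "n - 1" x] by simp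

lemma int_scale_1 [simp]: "int_scale 1 x = x"
  using int_scale_Suc[of 0 x] by simp

lemma int_scale_zero_right [simp]: "int_scale n 0 = 0"
  by (simp add: int_scale_def)

lemma int_scale_add_left: "int_scale (m + n) x = int_scale m x + int_scale n x"
proof (induction n rule: int_induct[where k = 0])
  case (step1 i)
  then show ?case by (simp add: int_scale_Suc flip: add.assoc)
next
  case (step2 i)
  then show ?case by (simp add: int_scale_pred add_diff_eq)
qed simp

lemma int_scale_add_right: "int_scale n (x + y) = int_scale n x + int_scale n y"
  by (induction n rule: int_induct[where k = 0])
    (simp_all add: int_scale_Suc int_scale_pred algebra_simps)

lemma int_scale_diff_left: "int_scale (m - n) x = int_scale m x - int_scale n x"
  using int_scale_add_left[of "m - n" n x] by simp

lemma int_scale_mult: "int_scale (m * n) x = int_scale m (int_scale n x)"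
  by (induction m rule: int_induct[where k = 0])
    (simp_all add: int_scale_Suc int_scale_pred int_scale_add_left int_scale_diff_left
      distrib_right left_diff_distrib)

lemma int_scale_mult_left: "int_scale n x * y = int_scale n (x * y)"
  by (induction n rule: int_induct[where k = 0])
    (simp_all add: int_scale_Suc int_scale_pred algebra_simps)

text \<open>
  Together with the preceding laws, this makes the ring an algebra over the integers, as needed for
  the product on the extension.
\<close>

lemma int_scale_mult_right: "x * int_scale n y = int_scale n (x * y)"
  by (induction n rule: int_induct[where k = 0])
    (simp_all add: int_scale_Suc int_scale_pred algebra_simps)

text \<open>
  The ring with a unit adjoined. Integer scalars are used in place of the field \<open>K\<close> because their action
  is determined by the addition, so that the extension is a type of class \<open>ring_1\<close> and power series over
  it form a ring. This loses nothing: the elements of the group have scalar part \<open>1\<close>.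
\<close>

datatype 'a dorroh = Dorroh int 'a

instantiation dorroh :: (ring) ring_1
begin

definition "0 = Dorroh 0 0"
definition "1 = Dorroh 1 0"

fun plus_dorroh where "Dorroh m x + Dorroh n y = Dorroh (m + n) (x + y)"
fun uminus_dorroh where "- Dorroh m x = Dorroh (- m) (- x)"
fun minus_dorroh where "Dorroh m x - Dorroh n y = Dorroh (m - n) (x - y)"
fun times_dorroh where
  "Dorroh m x * Dorroh n y = Dorroh (m * n) (int_scale m y + int_scale n x + x * y)"

instance
proof
  fix x y z :: "'a dorroh"
  show "x * y * z = x * (y * z)"
    by (cases x; cases y; cases z) (simp add: algebra_simps int_scale_add_right int_scale_mult_left
        int_scale_mult_right flip: int_scale_mult)
  show "(x + y) * z = x * z + y * z" "x * (y + z) = x * y + x * z"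
    by (cases x; cases y; cases z; simp add: algebra_simps int_scale_add_right int_scale_add_left)+
  show "x + y + z = x + (y + z)"
    by (cases x; cases y; cases z) (simp add: add_ac)
  show "x + y = y + x" by (cases x; cases y) (simp add: add_ac)
  show "x - y = x + - y" by (cases x; cases y) simp
  show "0 + x = x" "1 * x = x" "x * 1 = x" "- x + x = 0"
    by (cases x; simp add: zero_dorroh_def one_dorroh_def)+
  show "(0 :: 'a dorroh) \<noteq> 1" by (simp add: zero_dorroh_def one_dorroh_def)
qed

end

abbreviation embed :: "'a::ring \<Rightarrow> 'a dorroh" where "embed \<equiv> Dorroh 0"

lemma embed_0: "embed 0 = 0"
  by (simp add: zero_dorroh_def)

lemma embed_add: "embed (x + y) = embed x + embed y"
  by simp

lemma embed_sum: "embed (sum f A) = (\<Sum>i\<in>A. embed (f i))"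
  by (induction A rule: infinite_finite_induct) (simp_all add: embed_0 embed_add del: plus_dorroh.simps)

lemma of_nat_dorroh: "of_nat n = Dorroh (int n) 0"
  by (induction n) (simp_all add: zero_dorroh_def one_dorroh_def)

text \<open>
  Scalars are central, so a commutator in the extension is a commutator of elements of the ring.
\<close>

lemma annihilates_commutators_embed:
  assumes "\<forall>x y z :: 'a::ring. x * (y * z - z * y) = 0"
  shows "embed (x :: 'a) * (u * v) = embed x * (v * u)"
  using assms by (cases u; cases v) (simp add: algebra_simps)

section \<open>The product of the group as composition of power series\<close>

definition embed_fps :: "'a::ring fps \<Rightarrow> 'a dorroh fps" where
  "embed_fps f = Abs_fps (\<lambda>n. embed (f $ n))"

lemma embed_fps_nth [simp]: "embed_fps f $ n = embed (f $ n)"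
  by (simp add: embed_fps_def)

lemma embed_fps_add: "embed_fps (f + g) = embed_fps f + embed_fps g"
  by (simp add: fps_eq_iff)

lemma embed_fps_mult: "embed_fps (f * g) = embed_fps f * embed_fps g"
  by (simp add: fps_eq_iff fps_mult_nth embed_sum)

text \<open>
  The series \<open>X + \<Sum> f\<^sub>n X\<^bsup>n+1\<^esup>\<close> attached to the group element \<open>1 + f\<close>, the shift by one degree accounting for
  the exponent \<open>m + 1\<close> in the product of the group.
\<close>

definition tangent_series :: "'a::ring fps \<Rightarrow> 'a dorroh fps" where
  "tangent_series f = fps_X * (1 + embed_fps f)"

lemma tangent_series_nth_0 [simp]: "tangent_series f $ 0 = 0"
  by (simp add: tangent_series_def)

lemma tangent_series_nth_Suc: "tangent_series f $ Suc n = (1 + embed_fps f) $ n"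
  by (simp add: tangent_series_def)

lemma tangent_series_eq_iff: "tangent_series f = tangent_series g \<longleftrightarrow> f = g"
proof
  assume *: "tangent_series f = tangent_series g"
  show "f = g"
  proof (rule fps_ext)
    fix n
    have "(1 + embed_fps f) $ n = (1 + embed_fps g) $ n"
      using * by (simp only: flip: tangent_series_nth_Suc)
    then show "f $ n = g $ n" by simp
  qed
qed simp

lemma tangent_series_0: "tangent_series 0 = fps_X"
  by (simp add: tangent_series_def fps_eq_iff embed_0)

definition homogeneous_fps :: "'a::zero \<Rightarrow> nat \<Rightarrow> 'a fps" where
  "homogeneous_fps a m = Abs_fps (\<lambda>n. if n = m then a else 0)"

lemma homogeneous_fps_nth [simp]: "homogeneous_fps a m $ n = (if n = m then a else 0)"
  by (simp add: homogeneous_fps_def)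

lemma embed_homogeneous_fps: "embed_fps (homogeneous_fps a m) = fps_const (embed a) * fps_X ^ m"
  by (simp add: fps_eq_iff embed_0)

lemma tangent_series_homogeneous:
  "tangent_series (homogeneous_fps a m) = perturbed_X (embed a) m"
proof -
  have "fps_X * (fps_const (embed a) * fps_X ^ m) = fps_const (embed a) * fps_X ^ (m + 1)"
    by (simp add: fps_mult_fps_X_commute mult.assoc power_Suc2 del: power_Suc)
  then show ?thesis
    by (simp add: tangent_series_def perturbed_X_def embed_homogeneous_fps distrib_left del: power_Suc)
qed

lemma fps_X_mult_power: "(fps_X * u) ^ k = fps_X ^ k * (u :: 'r::semiring_1 fps) ^ k"
proof (induction k)
  case (Suc k)
  have "(fps_X * u) ^ Suc k = fps_X * (u * fps_X ^ k) * u ^ k"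
    using Suc by (simp add: mult.assoc)
  also have "\<dots> = fps_X * (fps_X ^ k * u) * u ^ k"
    by (simp only: fps_mult_fps_X_power_commute)
  finally show ?case by (simp add: mult.assoc)
qed simp

text \<open>
  Since \<open>X\<close> is central, the powers of \<open>tangent_series g\<close> are those of \<open>1 + g\<close> multiplied by powers of \<open>X\<close>;
  the coefficient thus becomes the component of degree \<open>n\<close> of \<open>\<Sum> \<alpha>\<^sub>m \<beta>\<^bsup>m+1\<^esup>\<close>.
\<close>

lemma tangent_series_compose_nth:
  assumes "f $ 0 = 0"
  shows "(tangent_series f oo tangent_series g) $ Suc n =
    (\<Sum>m\<le>n. ((if m = 0 then 1 else embed (f $ m)) * ((1 + embed_fps g) ^ (m + 1)) $ (n - m)))"
proof -
  have "(tangent_series f oo tangent_series g) $ Suc n =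
      (\<Sum>m\<le>n. (tangent_series f) $ Suc m * (tangent_series g ^ Suc m) $ Suc n)"
    unfolding fps_compose_nth atLeast0AtMost
    by (subst sum.atMost_Suc_shift) (simp del: power_Suc)
  also have "\<dots> = (\<Sum>m\<le>n. ((if m = 0 then 1 else embed (f $ m)) * ((1 + embed_fps g) ^ (m + 1)) $ (n - m)))"
  proof (rule sum.cong[OF refl])
    fix m assume "m \<in> {..n}"
    then have "(tangent_series g ^ Suc m) $ Suc n = ((1 + embed_fps g) ^ Suc m) $ (n - m)"
      unfolding tangent_series_def fps_X_mult_power by (simp add: fps_X_power_mult_nth del: power_Suc)
    moreover have "tangent_series f $ Suc m = (if m = 0 then 1 else embed (f $ m))"
      using assms by (simp add: tangent_series_nth_Suc embed_0)
    ultimately show "(tangent_series f) $ Suc m * (tangent_series g ^ Suc m) $ Suc n =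
        (if m = 0 then 1 else embed (f $ m)) * ((1 + embed_fps g) ^ (m + 1)) $ (n - m)"
      by simp
  qed
  finally show ?thesis .
qed

text \<open>
  The solution \<open>c\<close> of \<open>c\<^sub>n + g\<^sub>n + \<Sum> c\<^sub>m P\<^bsub>m+1,n-m\<^esub> = 0\<close>, the sum being over \<open>0 < m < n\<close>. In the application
  \<open>1 + P k\<close> is the \<open>k\<close>-th power of \<open>1 + g\<close>.
\<close>

function left_inverse_coeff :: "(nat \<Rightarrow> 'a fps) \<Rightarrow> 'a::ring fps \<Rightarrow> nat \<Rightarrow> 'a" where
  "left_inverse_coeff P g n =
    (if n = 0 then 0
     else - (g $ n + (\<Sum>m\<in>{1..<n}. left_inverse_coeff P g m * P (m + 1) $ (n - m))))"
  by pat_completeness auto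
termination by (relation "measure (\<lambda>(P, g, n). n)") auto

declare left_inverse_coeff.simps [simp del]

context graded_algebra
begin

lemma fps_scale_1: "fps_scale scale 1 f = f"
  by (simp add: fps_scale_def fps_eq_iff)

lemma fps_scale_0: "fps_scale scale 0 f = 0"
  by (simp add: fps_scale_def fps_eq_iff)

lemma completion_nth: "f \<in> completion G \<Longrightarrow> f $ n \<in> G n"
  by (simp add: completion_def)

lemma completion_nth_0: "f \<in> completion G \<Longrightarrow> f $ 0 = 0"
  using completion_nth[of f 0] component_0 by simp

lemma zero_completion: "0 \<in> completion G"
  by (simp add: completion_def subspace_0[OF subspace_component])

lemma add_completion: "f \<in> completion G \<Longrightarrow> g \<in> completion G \<Longrightarrow> f + g \<in> completion G"
  by (simp add: completion_def subspace_add[OF subspace_component])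

lemma mult_completion:
  assumes "f \<in> completion G" "g \<in> completion G"
  shows "f * g \<in> completion G"
proof -
  have "f $ i * g $ (n - i) \<in> G n" if "i \<le> n" for i n
    using component_mult[OF completion_nth[OF assms(1), of i] completion_nth[OF assms(2), of "n - i"]] that
    by simp
  then show ?thesis
    by (auto simp: completion_def fps_mult_nth intro!: subspace_sum[OF subspace_component])
qed

lemma homogeneous_fps_completion: "a \<in> G m \<Longrightarrow> homogeneous_fps a m \<in> completion G"
  by (simp add: completion_def subspace_0[OF subspace_component])

definition power_part :: "'a fps \<Rightarrow> nat \<Rightarrow> 'a fps" where
  "power_part g k = snd ((1, g) [^]\<^bsub>unitization scale G\<^esub> k)"

lemma unitization_power: "(1, g) [^]\<^bsub>unitization scale G\<^esub> (k :: nat) = (1, power_part g k)"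
proof -
  have "fst ((1, g) [^]\<^bsub>unitization scale G\<^esub> k) = 1"
    by (induction k) (simp_all add: nat_pow_def unitization_def case_prod_unfold)
  then show ?thesis by (simp add: power_part_def prod_eq_iff)
qed

lemma power_part_0: "power_part g 0 = 0"
  by (simp add: power_part_def nat_pow_def unitization_def)

lemma power_part_Suc: "power_part g (Suc k) = g + power_part g k + power_part g k * g"
proof -
  have "(1, power_part g (Suc k)) = (1, power_part g k) \<otimes>\<^bsub>unitization scale G\<^esub> (1, g)"
    by (simp add: nat_pow_def flip: unitization_power)
  then show ?thesis
    by (simp add: unitization_def fps_scale_1)
qed

text \<open>
  Powers formed after adjoining the field and powers formed after adjoining the integers agree, since on elements with scalar part \<open>1\<close> the two products are given by the same formula.
\<close>

lemma one_plus_embed_power_part: "1 + embed_fps (power_part g k) = (1 + embed_fps g) ^ k"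
proof (induction k)
  case 0
  then show ?case by (simp add: power_part_0 fps_eq_iff embed_0)
next
  case (Suc k)
  then show ?case
    by (simp only: power_Suc2 flip: Suc)
      (simp add: power_part_Suc embed_fps_add embed_fps_mult algebra_simps)
qed

lemma power_part_completion: "g \<in> completion G \<Longrightarrow> power_part g k \<in> completion G"
  by (induction k) (simp_all add: power_part_0 power_part_Suc zero_completion add_completion mult_completion)

lemma Jg_summand_0: "Jg_summand scale G (1, f) (1, g) 0 = (1, g)"
  unfolding Jg_summand_def unitization_power
  by (simp add: hom_component_def unitization_def fps_scale_1 power_part_Suc power_part_0)

lemma Jg_summand_pos:
  assumes "m > 0"
  shows "Jg_summand scale G (1, f) (1, g) m =
    (0, homogeneous_fps (f $ m) m + homogeneous_fps (f $ m) m * power_part g (m + 1))"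
  unfolding Jg_summand_def unitization_power
  using assms by (simp add: hom_component_def unitization_def fps_scale_0 fps_scale_1
      flip: homogeneous_fps_def)

definition Jg_product :: "'a fps \<Rightarrow> 'a fps \<Rightarrow> 'a fps" where
  "Jg_product f g = snd ((1, f) \<otimes>\<^bsub>Jg scale G\<^esub> (1, g))"

lemma Jg_product_nth:
  "Jg_product f g $ n = (\<Sum>m\<le>n. snd (Jg_summand scale G (1, f) (1, g) m) $ n)"
  unfolding Jg_product_def Jg_def gradedwise_sum_def
  by (auto intro!: Sum_any.expand_superset intro: nth_Jg_summand_eq_0 simp: not_le[symmetric])

lemma Jg_mult: "(1, f) \<otimes>\<^bsub>Jg scale G\<^esub> (1, g) = (1, Jg_product f g)"
proof -
  have "Sum_any (\<lambda>m. fst (Jg_summand scale G (1, f) (1, g) m)) =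
      Sum_any (\<lambda>m :: nat. if m = 0 then 1 else 0)"
    by (intro arg_cong[where f = Sum_any] ext) (simp add: Jg_summand_0 fst_Jg_summand_eq_0)
  then show ?thesis
    by (simp add: Jg_product_def Jg_def gradedwise_sum_def)
qed

lemma Jg_product_completion:
  assumes "f \<in> completion G" "g \<in> completion G"
  shows "Jg_product f g \<in> completion G"
proof -
  have "snd (Jg_summand scale G (1, f) (1, g) m) \<in> completion G" for m
    using assms
    by (cases "m = 0") (simp_all add: Jg_summand_0 Jg_summand_pos add_completion mult_completion
        homogeneous_fps_completion completion_nth power_part_completion)
  then show ?thesis
    by (auto simp: completion_def Jg_product_nth intro!: subspace_sum[OF subspace_component])
qed

text \<open>
  The summand \<open>\<alpha>\<^sub>m \<beta>\<^bsup>m+1\<^esup>\<close> becomes \<open>\<alpha>\<^sub>m X\<^sup>m (1 + g)\<^bsup>m+1\<^esup>\<close>. The only discrepancy is the unit, which occurs in the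
  summand for \<open>m = 0\<close> and is not part of \<open>Jg_product f g\<close>; it is added separately.
\<close>

lemma tangent_series_Jg_product:
  assumes "f \<in> completion G"
  shows "tangent_series (Jg_product f g) = tangent_series f oo tangent_series g"
proof (rule fps_ext)
  fix k
  show "tangent_series (Jg_product f g) $ k = (tangent_series f oo tangent_series g) $ k"
  proof (cases k)
    case (Suc n)
    have summand: "(if m = 0 then 1 $ n else 0) + embed (snd (Jg_summand scale G (1, f) (1, g) m) $ n) =
        (if m = 0 then 1 else embed (f $ m)) * ((1 + embed_fps g) ^ (m + 1)) $ (n - m)"
      if "m \<le> n" for m
    proof (cases "m = 0")
      case False
      have "embed_fps (snd (Jg_summand scale G (1, f) (1, g) m)) =
          fps_const (embed (f $ m)) * (fps_X ^ m * (1 + embed_fps (power_part g (m + 1))))"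
        using False by (simp add: Jg_summand_pos embed_fps_add embed_fps_mult embed_homogeneous_fps
            distrib_left mult.assoc)
      then have "embed_fps (snd (Jg_summand scale G (1, f) (1, g) m)) $ n =
          embed (f $ m) * ((1 + embed_fps g) ^ (m + 1)) $ (n - m)"
        unfolding one_plus_embed_power_part using that
        by (simp add: fps_X_power_mult_nth del: power_Suc embed_fps_nth)
      then show ?thesis using False by (simp del: power_Suc)
    qed (simp add: Jg_summand_0)
    have "tangent_series (Jg_product f g) $ k =
        (\<Sum>m\<le>n. if m = 0 then 1 $ n else 0) +
        (\<Sum>m\<le>n. embed (snd (Jg_summand scale G (1, f) (1, g) m) $ n))"
      using Suc by (simp only: tangent_series_nth_Suc fps_add_nth embed_fps_nth Jg_product_nth embed_sum)
        (simp add: sum.delta')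
    also have "\<dots> = (tangent_series f oo tangent_series g) $ k"
      unfolding Suc tangent_series_compose_nth[OF completion_nth_0[OF assms]] sum.distrib[symmetric]
      by (rule sum.cong[OF refl], rule summand) simp
    finally show ?thesis .
  qed simp
qed

text \<open>
  In the summand of index \<open>n\<close>, only the unit of \<open>\<beta>\<^bsup>n+1\<^esup>\<close> contributes in degree \<open>n\<close>, because the completion has
  no component of degree \<open>0\<close>. Hence \<open>f $ n\<close> occurs linearly and with coefficient \<open>1\<close>, and the equation
  \<open>Jg_product f g = 0\<close> can be solved recursively for \<open>f\<close>.
\<close>

lemma Jg_product_nth_eq:
  assumes "g \<in> completion G" "n > 0"
  shows "Jg_product f g $ n = f $ n + (g $ n + (\<Sum>m\<in>{1..<n}. f $ m * power_part g (m + 1) $ (n - m)))"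
proof -
  have *: "snd (Jg_summand scale G (1, f) (1, g) m) $ n =
      (if m = n then f $ n else 0) + f $ m * power_part g (m + 1) $ (n - m)"
    if "0 < m" "m \<le> n" for m
  proof -
    have "(homogeneous_fps (f $ m) m * p) $ n = f $ m * p $ (n - m)" for p
      using that by (simp add: fps_mult_nth if_distrib[of "\<lambda>x. x * _"] cong: if_cong)
    then show ?thesis
      using that by (auto simp: Jg_summand_pos)
  qed
  have "Jg_product f g $ n = g $ n + (\<Sum>m\<in>{1..n}. snd (Jg_summand scale G (1, f) (1, g) m) $ n)"
    unfolding Jg_product_nth atMost_atLeast0
    by (simp add: sum.atLeast_Suc_atMost Jg_summand_0)
  also have "(\<Sum>m\<in>{1..n}. snd (Jg_summand scale G (1, f) (1, g) m) $ n) =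
      (\<Sum>m\<in>{1..n}. (if m = n then f $ n else 0) + f $ m * power_part g (m + 1) $ (n - m))"
    by (rule sum.cong[OF refl], rule *) auto
  also have "\<dots> = f $ n + (\<Sum>m\<in>{1..n}. f $ m * power_part g (m + 1) $ (n - m))"
    using assms(2) by (simp add: sum.distrib)
  also have "(\<Sum>m\<in>{1..n}. f $ m * power_part g (m + 1) $ (n - m)) =
      (\<Sum>m\<in>{1..<n}. f $ m * power_part g (m + 1) $ (n - m))"
    by (rule sum.mono_neutral_right)
      (auto simp: completion_nth_0[OF power_part_completion[OF assms(1)]] dest: le_neq_implies_less)
  finally show ?thesis by (simp add: add_ac)
qed

lemma Jg_left_inverse:
  assumes g: "g \<in> completion G"
  obtains f where "f \<in> completion G" "Jg_product f g = 0"
proof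
  let ?c = "left_inverse_coeff (power_part g) g"
  have "?c n \<in> G n" for n
  proof (induction n rule: less_induct)
    case (less n)
    have "?c m * power_part g (m + 1) $ (n - m) \<in> G n" if "m \<in> {1..<n}" for m
      using component_mult[OF less[of m] completion_nth[OF power_part_completion[OF g], of "m + 1" "n - m"]] that
      by simp
    then show ?case
      by (subst left_inverse_coeff.simps)
        (auto intro!: subspace_neg[OF subspace_component] subspace_diff[OF subspace_component] subspace_add[OF subspace_component]
          subspace_sum[OF subspace_component] subspace_0[OF subspace_component] completion_nth[OF g])
  qed
  then show f: "Abs_fps ?c \<in> completion G"
    by (simp add: completion_def)
  show "Jg_product (Abs_fps ?c) g = 0"
  proof (rule fps_ext)
    fix n
    show "Jg_product (Abs_fps ?c) g $ n = 0 $ n"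
    proof (cases "n = 0")
      case True
      then show ?thesis using completion_nth_0[OF Jg_product_completion[OF f g]] by simp
    next
      case False
      then show ?thesis
        using Jg_product_nth_eq[OF g, of n "Abs_fps ?c"] left_inverse_coeff.simps[of "power_part g" g n]
        by simp
    qed
  qed
qed

section \<open>Associativity and commutators\<close>

lemma Jg_product_assoc:
  assumes "\<forall>x y z :: 'a. x * (y * z - z * y) = 0"
    and "f \<in> completion G" "g \<in> completion G" "h \<in> completion G"
  shows "Jg_product (Jg_product f g) h = Jg_product f (Jg_product g h)"
proof -
  have "annihilates_commutators (tangent_series f $ i)" if "i \<ge> 2" for i
  proof -
    from that obtain j where "i = Suc (Suc j)"
      by (metis Suc_le_D numeral_2_eq_2 Suc_le_mono)
    then show ?thesis
      using annihilates_commutators_embed[OF assms(1)]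
      by (simp add: tangent_series_nth_Suc annihilates_commutators_def)
  qed
  then have "(tangent_series f oo tangent_series g) oo tangent_series h =
      tangent_series f oo (tangent_series g oo tangent_series h)"
    by (intro fps_compose_assoc_annihilator) simp_all
  then show ?thesis
    using assms(2-4)
    by (subst tangent_series_eq_iff[symmetric]) (simp add: tangent_series_Jg_product Jg_product_completion)
qed

lemma group_Jg:
  assumes "\<forall>x y z :: 'a. x * (y * z - z * y) = 0"
  shows "group (Jg scale G)"
proof (rule groupI)
  have carrier: "x \<in> carrier (Jg scale G) \<longleftrightarrow> (\<exists>f\<in>completion G. x = (1, f))" for x
    by (auto simp: Jg_def)
  have one: "\<one>\<^bsub>Jg scale G\<^esub> = (1, 0)"
    by (simp add: Jg_def)
  show "\<one>\<^bsub>Jg scale G\<^esub> \<in> carrier (Jg scale G)"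
    using zero_completion by (auto simp: carrier one)
  fix x y z
  assume x: "x \<in> carrier (Jg scale G)"
  show "\<one>\<^bsub>Jg scale G\<^esub> \<otimes>\<^bsub>Jg scale G\<^esub> x = x"
  proof -
    have "Jg_product 0 f = f" for f
      using tangent_series_Jg_product[OF zero_completion, of f]
      by (simp add: tangent_series_0 fps_X_compose tangent_series_eq_iff)
    then show ?thesis using x by (auto simp: carrier one Jg_mult)
  qed
  show "\<exists>y\<in>carrier (Jg scale G). y \<otimes>\<^bsub>Jg scale G\<^esub> x = \<one>\<^bsub>Jg scale G\<^esub>"
  proof -
    from x obtain g where g: "g \<in> completion G" "x = (1, g)"
      by (auto simp: carrier)
    from Jg_left_inverse[OF g(1)] obtain f where "f \<in> completion G" "Jg_product f g = 0" .
    then show ?thesis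
      using g by (intro bexI[of _ "(1, f)"]) (simp_all add: carrier one Jg_mult)
  qed
  assume y: "y \<in> carrier (Jg scale G)"
  show "x \<otimes>\<^bsub>Jg scale G\<^esub> y \<in> carrier (Jg scale G)"
    using x y by (auto simp: carrier Jg_mult Jg_product_completion)
  assume "z \<in> carrier (Jg scale G)"
  with x y show "x \<otimes>\<^bsub>Jg scale G\<^esub> y \<otimes>\<^bsub>Jg scale G\<^esub> z = x \<otimes>\<^bsub>Jg scale G\<^esub> (y \<otimes>\<^bsub>Jg scale G\<^esub> z)"
    using Jg_product_assoc[OF assms] by (auto simp: carrier Jg_mult)
qed

lemma int_scale_eq_scale: "int_scale (int n) x = scale (of_nat n) x"
proof (induction n)
  case (Suc n)
  then show ?case
    using int_scale_Suc[of "int n" x] by (simp add: scale_left_distrib add_ac)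
qed simp

text \<open>
  The group elements \<open>1 + a\<close>, \<open>1 + b\<close>, \<open>1 + c\<close> suffice. The integer factor from the defect is turned into a
  scalar of the field, where it can be cancelled.
\<close>

lemma homogeneous_commutator_eq_0:
  assumes group: "group (Jg scale G)"
    and char: "of_nat (Suc m choose 2) \<noteq> (0 :: 'k)"
    and pos: "n > 0" "p > 0"
    and a: "a \<in> G m" and b: "b \<in> G n" and c: "c \<in> G p"
  shows "a * (b * c - c * b) = 0"
proof -
  let ?f = "homogeneous_fps a m" and ?g = "homogeneous_fps b n" and ?h = "homogeneous_fps c p"
  have compl: "?f \<in> completion G" "?g \<in> completion G" "?h \<in> completion G"
    using a b c by (simp_all add: homogeneous_fps_completion)
  have "(1, ?f) \<otimes>\<^bsub>Jg scale G\<^esub> (1, ?g) \<otimes>\<^bsub>Jg scale G\<^esub> (1, ?h) =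
      (1, ?f) \<otimes>\<^bsub>Jg scale G\<^esub> ((1, ?g) \<otimes>\<^bsub>Jg scale G\<^esub> (1, ?h))"
    by (rule monoid.m_assoc[OF group.is_monoid[OF group]]) (use compl in \<open>simp_all add: Jg_def\<close>)
  then have "Jg_product (Jg_product ?f ?g) ?h = Jg_product ?f (Jg_product ?g ?h)"
    by (simp add: Jg_mult)
  then have "(tangent_series ?f oo tangent_series ?g) oo tangent_series ?h =
      tangent_series ?f oo (tangent_series ?g oo tangent_series ?h)"
    using compl by (metis tangent_series_Jg_product Jg_product_completion)
  then have "embed a * (of_nat (Suc m choose 2) * (embed c * embed b - embed b * embed c)) = 0"
    unfolding tangent_series_homogeneous by (rule commutator_eq_0_if_compose_assoc[OF pos])
  then have "int_scale (int (Suc m choose 2)) (a * (c * b - b * c)) = 0"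
    by (simp add: of_nat_dorroh zero_dorroh_def int_scale_mult_right del: binomial_Suc_Suc)
  then have "a * (c * b - b * c) = 0"
    using char by (simp only: int_scale_eq_scale scale_eq_0_iff) simp
  then show ?thesis by (simp add: algebra_simps)
qed

lemma homogeneous_induct:
  assumes hom: "\<And>n x. x \<in> G n \<Longrightarrow> P x" and add: "\<And>x y. P x \<Longrightarrow> P y \<Longrightarrow> P (x + y)"
  shows "P x"
proof -
  from direct_sum[of x] obtain c where c: "\<forall>n. c n \<in> G n" "finite {n. c n \<noteq> 0}" "x = Sum_any c"
    by blast
  have "P (sum c A)" if "finite A" for A
    using that
  proof induction
    case empty
    show ?case using hom[of 0 0] component_0 by simp
  next
    case (insert i A)
    have "P (c i)" using c(1) by (intro hom) auto
    with insert show ?case by (simp add: add)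
  qed
  then show ?thesis
    using c by (simp add: Sum_any.expand_set)
qed

lemma commutators_eq_0_if_homogeneous:
  assumes "\<And>m n p a b c. a \<in> G m \<Longrightarrow> b \<in> G n \<Longrightarrow> c \<in> G p \<Longrightarrow> a * (b * c - c * b) = 0"
  shows "x * (y * z - z * y) = (0 :: 'a)"
proof (induction x rule: homogeneous_induct)
  case a: (1 m a)
  show ?case
  proof (induction y rule: homogeneous_induct)
    case b: (1 n b)
    show ?case
    proof (induction z rule: homogeneous_induct)
      case (1 p c)
      with a b show ?case by (rule assms)
    next
      case (2 c c')
      have "a * (b * (c + c') - (c + c') * b) = a * (b * c - c * b) + a * (b * c' - c' * b)"
        by (simp add: algebra_simps)
      then show ?case by (simp only: 2 add_0)
    qed
  next
    case (2 b b')
    have "a * ((b + b') * z - z * (b + b')) = a * (b * z - z * b) + a * (b' * z - z * b')"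
      by (simp add: algebra_simps)
    then show ?case by (simp only: 2 add_0)
  qed
next
  case (2 a a')
  then show ?case by (simp only: distrib_right add_0)
qed

end

theorem proposition2p4:
  fixes scale :: "'k::field_char_0 \<Rightarrow> 'a::ring \<Rightarrow> 'a"
    and G :: "nat \<Rightarrow> 'a set"
  assumes "graded_algebra scale G"
  shows "group (Jg scale G) \<longleftrightarrow> (\<forall>x y z :: 'a. x * (y * z - z * y) = 0)"
proof
  interpret graded_algebra scale G by fact
  show "group (Jg scale G)" if "\<forall>x y z :: 'a. x * (y * z - z * y) = 0"
    using that by (rule group_Jg)
  assume group: "group (Jg scale G)"
  show "\<forall>x y z :: 'a. x * (y * z - z * y) = 0"
  proof (intro allI, rule commutators_eq_0_if_homogeneous)
    fix m n p a b c
    assume abc: "a \<in> G m" "b \<in> G n" "c \<in> G p"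
    show "a * (b * c - c * b) = 0"
      (* The defect needs positive degrees; the component of degree 0 is zero. *)
    proof (cases "m = 0 \<or> n = 0 \<or> p = 0")
      case True
      then have "a = 0 \<or> b = 0 \<or> c = 0"
        using abc component_0 by auto
      then show ?thesis by auto
    next
      case False
      then have "Suc m choose 2 \<noteq> 0"
        by (simp add: binomial_eq_0_iff)
      then have "of_nat (Suc m choose 2) \<noteq> (0 :: 'k)"
        by (simp only: of_nat_eq_0_iff) simp
      with False abc show ?thesis
        by (intro homogeneous_commutator_eq_0[OF group]) auto
    qed
  qed
qed

end
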